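(* Let $0<m\le L<\infty$, let $f:\mathbb{R}^p\to\mathbb{R}\cup\{+\infty\}$ be convex, closed and proper with $f\in S_p(m,L)$, and let $\kappa=L/m\ge1$. Consider Nesterov's accelerated method with parameters $\alpha,\beta$ (defined in the context) applied to the problem $\min_{x\in\mathbb{R}^p}f(x)$, started from $x_0,x_1\in\mathbb{R}^p$, and let $x_*$ be the fixed point of the method (equivalently, the unique minimizer of $f$). If $$\alpha=\frac1L\qquad\text{and}\qquad \beta=\frac{2\kappa-\sqrt{2\kappa-1}-1}{2\left(\kappa+\sqrt{2\kappa-1}\right)},$$ then, for all $t\ge0$, $$\|x_t-x_*\|\le C_0C_1\,\tau^t,$$ where $C_0=\sqrt{\|x_1-x_*\|^2+\|x_0-x_*\|^2}$, $C_1>0$ is a function of $\kappa$ (only), and $$\tau=\sqrt{1-\frac{\sqrt{2\kappa-1}}{\kappa}}.$$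
   Context: $\|\cdot\|$ is the Euclidean norm. $S_d(m,L)$ is the set of functions $h:\mathbb{R}^d\to\mathbb{R}\cup\{+\infty\}$ such that $$m\|x-y\|^2\le(\nabla h(x)-\nabla h(y))^T(x-y)\le L\|x-y\|^2\quad\text{for all }x,y\in\mathbb{R}^d,$$ where $0<m\le L<\infty$; thus $f\in S_p(m,L)$ means that $f$ is strongly convex and $\nabla f$ is Lipschitz continuous. Nesterov's accelerated method with fixed parameters $\alpha>0$, $\beta\ge0$: given initial points $x_0,x_1\in\mathbb{R}^p$, iterate for $t=1,2,\dots$ $$y_t=(1+\beta)x_t-\beta x_{t-1},\qquad x_{t+1}=y_t-\alpha\nabla f(y_t).$$ A fixed point of the method is a point $x_*$ such that $x_t=x_{t-1}=x_*$ implies $x_{t+1}=x_*$. The convention $0^0=1$ is used.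
   Formalization: The bound is not claimed for the single pair κ = 1, t = 1: there τ = 0, so it would force the arbitrary starting point x_1 to equal x_* (false for f(x)=x²/2, x_0=0, x_1=1); all t ≥ 0 for κ > 1, and t = 0 and t ≥ 2 for κ = 1, are covered. *)

theory Defs
  imports "HOL-Analysis.Analysis"
begin

text \<open>
  The dimension \<open>p\<close> has to be quantified inside the statement, because the constant \<open>C1\<close>
  must not depend on it. Hence \<open>\<real>\<^sup>p\<close> is the library's \<^const>\<open>Euclidean_space\<close> \<open>p\<close>, whose
  points are the sequences \<open>nat \<Rightarrow> real\<close> vanishing at all indices \<open>\<ge> p\<close>, and whose topology is
  the usual one. The type \<^typ>\<open>ereal\<close> also contains \<open>-\<infinity>\<close>, which is excluded explicitly.
  Only the values of a function on \<open>\<real>\<^sup>p\<close> matter.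
\<close>

abbreviation Rn :: "nat \<Rightarrow> (nat \<Rightarrow> real) set"
  where "Rn p \<equiv> topspace (Euclidean_space p)"

definition einner :: "nat \<Rightarrow> (nat \<Rightarrow> real) \<Rightarrow> (nat \<Rightarrow> real) \<Rightarrow> real"
  where "einner p x y = (\<Sum>i<p. x i * y i)"

definition enorm :: "nat \<Rightarrow> (nat \<Rightarrow> real) \<Rightarrow> real"
  where "enorm p x = L2_set x {..<p}"

definition vdiff :: "(nat \<Rightarrow> real) \<Rightarrow> (nat \<Rightarrow> real) \<Rightarrow> nat \<Rightarrow> real"
  where "vdiff x y = (\<lambda>i. x i - y i)"

definition proper_fun :: "nat \<Rightarrow> ((nat \<Rightarrow> real) \<Rightarrow> ereal) \<Rightarrow> bool"
  where "proper_fun p f \<longleftrightarrow> (\<forall>x\<in>Rn p. f x \<noteq> -\<infinity>) \<and> (\<exists>x\<in>Rn p. f x \<noteq> \<infinity>)"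

definition convex_fun :: "nat \<Rightarrow> ((nat \<Rightarrow> real) \<Rightarrow> ereal) \<Rightarrow> bool"
  where "convex_fun p f \<longleftrightarrow>
    (\<forall>x\<in>Rn p. \<forall>y\<in>Rn p. \<forall>u\<in>{0..1}.
       f (\<lambda>i. u * x i + (1 - u) * y i) \<le> ereal u * f x + ereal (1 - u) * f y)"

definition closed_fun :: "nat \<Rightarrow> ((nat \<Rightarrow> real) \<Rightarrow> ereal) \<Rightarrow> bool"
  where "closed_fun p f \<longleftrightarrow>
    closedin (prod_topology (Euclidean_space p) euclideanreal)
      {(x, r). x \<in> Rn p \<and> f x \<le> ereal r}"

text \<open>
  Frechet differentiability at \<open>x\<close> with gradient \<open>g\<close> (compare \<^const>\<open>gderiv\<close>): a function with
  values in \<open>\<real> \<union> {+\<infinity>}\<close> can be differentiable only at points near which it is finite.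
\<close>

definition has_gradient :: "nat \<Rightarrow> ((nat \<Rightarrow> real) \<Rightarrow> ereal) \<Rightarrow> (nat \<Rightarrow> real) \<Rightarrow> (nat \<Rightarrow> real) \<Rightarrow> bool"
  where "has_gradient p f g x \<longleftrightarrow>
    g \<in> Rn p \<and>
    (\<forall>\<^sub>F y in nhdsin (Euclidean_space p) x. \<bar>f y\<bar> \<noteq> \<infinity>) \<and>
    ((\<lambda>y. (real_of_ereal (f y) - real_of_ereal (f x) - einner p g (vdiff y x))
            / enorm p (vdiff y x)) \<longlongrightarrow> 0) (atin (Euclidean_space p) x)"

definition grad :: "nat \<Rightarrow> ((nat \<Rightarrow> real) \<Rightarrow> ereal) \<Rightarrow> (nat \<Rightarrow> real) \<Rightarrow> nat \<Rightarrow> real"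
  where "grad p f x = (THE g. has_gradient p f g x)"

definition S_class :: "nat \<Rightarrow> real \<Rightarrow> real \<Rightarrow> ((nat \<Rightarrow> real) \<Rightarrow> ereal) set"
  where "S_class p m L = {h.
    (\<forall>x\<in>Rn p. h x \<noteq> -\<infinity>) \<and>
    (\<forall>x\<in>Rn p. \<exists>g. has_gradient p h g x) \<and>
    (\<forall>x\<in>Rn p. \<forall>y\<in>Rn p.
       m * (enorm p (vdiff x y))\<^sup>2 \<le> einner p (vdiff (grad p h x) (grad p h y)) (vdiff x y) \<and>
       einner p (vdiff (grad p h x) (grad p h y)) (vdiff x y) \<le> L * (enorm p (vdiff x y))\<^sup>2)}"

text \<open>One step of the method, from the previous iterate \<open>u\<close> and the current iterate \<open>v\<close>.\<close>

definition nesterov_step ::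
    "nat \<Rightarrow> real \<Rightarrow> real \<Rightarrow> ((nat \<Rightarrow> real) \<Rightarrow> ereal) \<Rightarrow> (nat \<Rightarrow> real) \<Rightarrow> (nat \<Rightarrow> real) \<Rightarrow> nat \<Rightarrow> real"
  where "nesterov_step p \<alpha> \<beta> f u v =
    (let y = (\<lambda>i. (1 + \<beta>) * v i - \<beta> * u i) in (\<lambda>i. y i - \<alpha> * grad p f y i))"

definition nesterov_iterates ::
    "nat \<Rightarrow> real \<Rightarrow> real \<Rightarrow> ((nat \<Rightarrow> real) \<Rightarrow> ereal) \<Rightarrow> (nat \<Rightarrow> nat \<Rightarrow> real) \<Rightarrow> bool"
  where "nesterov_iterates p \<alpha> \<beta> f x \<longleftrightarrow>
    x 0 \<in> Rn p \<and> x 1 \<in> Rn p \<and>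
    (\<forall>t\<ge>1. x (t + 1) = nesterov_step p \<alpha> \<beta> f (x (t - 1)) (x t))"

definition nesterov_fixed_point ::
    "nat \<Rightarrow> real \<Rightarrow> real \<Rightarrow> ((nat \<Rightarrow> real) \<Rightarrow> ereal) \<Rightarrow> (nat \<Rightarrow> real) \<Rightarrow> bool"
  where "nesterov_fixed_point p \<alpha> \<beta> f z \<longleftrightarrow> z \<in> Rn p \<and> nesterov_step p \<alpha> \<beta> f z z = z"

text \<open>
  Pitfall in the rate \<open>\<tau>\<close>: if \<open>\<kappa> = 1\<close> then \<open>\<tau> = 0\<close>, so at \<open>t = 1\<close> a bound \<open>C0 * C1 * \<tau> ^ t\<close> would
  force the freely chosen starting point \<open>x 1\<close> to be the minimizer. A convergence statement
  admitting \<open>\<kappa> = 1\<close> therefore has to leave out this single pair \<open>\<kappa> = 1\<close>, \<open>t = 1\<close>.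
  For \<open>t = 0\<close> the convention \<open>0 ^ 0 = 1\<close> is that of the power on natural exponents.
\<close>

end

theory Submission
  imports Defs
begin

text \<open>
  After dividing by \<open>L\<close>, put \<open>n = 1 - 1/\<kappa>\<close> and \<open>s = sqrt (2\<kappa> - 1) / \<kappa>\<close>. Then \<open>n\<^sup>2 + s\<^sup>2 = 1\<close>,
  \<open>\<tau>\<^sup>2 = 1 - s\<close>, and everything about the parameters becomes algebra on the unit circle
  (\<open>rate_parameters\<close>).

  Subtracting \<open>\<parallel>y - x\<^sub>*\<parallel>\<^sup>2 / (2\<kappa>)\<close> from \<open>f / L\<close> leaves a convex function \<open>h\<close> of curvature at most \<open>n\<close>
  that is stationary at \<open>x\<^sub>*\<close> (\<open>S_class_smooth_convex\<close>). Its gradient at the extrapolated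
  point \<open>y\<^sub>t\<close> is \<open>n (y\<^sub>t - x\<^sub>*) - w\<^sub>t\<^sub>+\<^sub>1\<close>, where \<open>w\<^sub>t = x\<^sub>t - x\<^sub>*\<close>. Let
  \<open>\<phi>(y) = n (h(y) - h(x\<^sub>*)) - \<parallel>\<nabla>h(y)\<parallel>\<^sup>2 / 2\<close>. The interpolation inequality of smooth convex
  functions says that \<open>\<phi> \<ge> 0\<close> and, because the step size is \<open>1/L\<close>, also that
  \<open>\<phi>(y\<^sub>t) - \<phi>(y\<^sub>t\<^sub>-\<^sub>1) \<le> \<langle>\<nabla>h(y\<^sub>t), w\<^sub>t\<^sub>+\<^sub>1 - w\<^sub>t\<rangle>\<close> and \<open>\<phi>(y\<^sub>t) \<le> \<langle>\<nabla>h(y\<^sub>t), w\<^sub>t\<^sub>+\<^sub>1\<rangle>\<close>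
  (\<open>potential_diff_le\<close>).

  Hence \<open>V = Q(w\<^sub>t\<^sub>+\<^sub>1, w\<^sub>t) + \<phi>(y\<^sub>t)\<close> contracts by the factor \<open>1 - s\<close> in each step as soon as a certain
  quadratic form in \<open>w\<^sub>t\<^sub>+\<^sub>1, w\<^sub>t, w\<^sub>t\<^sub>-\<^sub>1\<close> is negative semidefinite. For the given \<open>\<beta>\<close> there is a form
  \<open>Q\<close> for which it is minus a single square (\<open>lyapunov_form_step\<close>), and this \<open>Q\<close> still dominates a positive
  multiple of \<open>\<parallel>w\<^sub>t\<^sub>+\<^sub>1\<parallel>\<^sup>2\<close> (\<open>lyapunov_form_lower\<close>). All forms act coordinatewise, so they are treated as
  statements about real numbers and summed.
\<close>

section \<open>Gradients along lines\<close>

text \<open>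
  For differentiable functions all the convexity estimates below are one-dimensional statements
  about restrictions to lines, so directional derivatives are all that is kept of the
  Frechet gradient.
\<close>

definition gateaux_gradient ::
    "nat \<Rightarrow> ((nat \<Rightarrow> real) \<Rightarrow> real) \<Rightarrow> (nat \<Rightarrow> real) \<Rightarrow> (nat \<Rightarrow> real) \<Rightarrow> bool"
  where "gateaux_gradient p h g x \<longleftrightarrow>
    (\<forall>d\<in>Rn p. ((\<lambda>s. h (\<lambda>i. x i + s * d i)) has_real_derivative einner p g d) (at 0))"

lemma Rn_iff: "x \<in> Rn p \<longleftrightarrow> (\<forall>i\<ge>p. x i = 0)"
  by (simp add: topspace_Euclidean_space)

lemma enorm_power2: "(enorm p x)\<^sup>2 = einner p x x"
  by (simp add: enorm_def einner_def L2_set_def sum_nonneg power2_eq_square)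

lemma enorm_nonneg: "0 \<le> enorm p x"
  by (simp add: enorm_def L2_set_nonneg)

lemma einner_self_nonneg: "0 \<le> einner p x x"
  by (metis enorm_power2 zero_le_power2)

lemma Rn_line: "x \<in> Rn p \<Longrightarrow> d \<in> Rn p \<Longrightarrow> (\<lambda>i. x i + s * d i) \<in> Rn p"
  by (simp add: Rn_iff)

lemma einner_self_eq_0D:
  assumes "einner p d d = 0" "d \<in> Rn p"
  shows "d = (\<lambda>i. 0)"
proof
  fix i
  have "\<forall>i\<in>{..<p}. d i * d i = 0"
    using assms(1) unfolding einner_def by (subst (asm) sum_nonneg_eq_0_iff) auto
  then show "d i = 0"
    using assms(2) by (cases "i < p") (auto simp: Rn_iff)
qed

lemma continuous_map_line:
  assumes "x \<in> Rn p" "d \<in> Rn p"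
  shows "continuous_map euclideanreal (Euclidean_space p) (\<lambda>s i. x i + s * d i)"
proof -
  have "continuous_map euclideanreal (powertop_real UNIV) (\<lambda>s i. x i + s * d i)"
    unfolding continuous_map_componentwise_UNIV
    by (auto intro!: continuous_intros)
  then show ?thesis
    using Rn_line[OF assms]
    by (auto simp: Euclidean_space_def continuous_map_in_subtopology)
qed

text \<open>
  The error of the difference quotient along a direction \<open>d\<close> is the Frechet quotient composed
  with the line \<open>s \<mapsto> x + s d\<close>, times the factor \<open>\<bar>s\<bar> \<parallel>d\<parallel> / s\<close>. That factor has no limit at \<open>0\<close> but is
  bounded, which is enough because the Frechet quotient tends to \<open>0\<close>.
\<close>

lemma has_gradient_imp_gateaux_gradient:
  assumes g: "has_gradient p f g x" and x: "x \<in> Rn p"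
  shows "gateaux_gradient p (\<lambda>y. real_of_ereal (f y)) g x"
  unfolding gateaux_gradient_def
proof
  fix d assume d: "d \<in> Rn p"
  let ?l = "\<lambda>s i. x i + s * d i"
  let ?F = "\<lambda>y. real_of_ereal (f y)"
  show "((\<lambda>s. ?F (?l s)) has_real_derivative einner p g d) (at 0)"
  proof (cases "d = (\<lambda>i. 0)")
    case True
    then show ?thesis by (simp add: einner_def)
  next
    case False
    then have dpos: "enorm p d > 0"
      using einner_self_eq_0D[OF _ d] enorm_power2[of p d] enorm_nonneg[of p d] by fastforce
    have lim: "((\<lambda>y. (?F y - ?F x - einner p g (vdiff y x)) / enorm p (vdiff y x)) \<longlongrightarrow> 0)
        (atin (Euclidean_space p) x)"
      using g by (simp add: has_gradient_def)
    have "filterlim ?l (atin (Euclidean_space p) x) (at 0)"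
      unfolding filterlim_iff
    proof (intro allI impI)
      fix P assume "eventually P (atin (Euclidean_space p) x)"
      then obtain U where U: "openin (Euclidean_space p) U" "x \<in> U" "\<forall>y\<in>U - {x}. P y"
        using x by (auto simp: eventually_atin)
      have "openin euclideanreal {s \<in> topspace euclideanreal. ?l s \<in> U}"
        using continuous_map_line[OF x d] U(1) openin_continuous_map_preimage by blast
      then have "open {s. ?l s \<in> U}" by simp
      moreover have "0 \<in> {s. ?l s \<in> U}" using U(2) by simp
      moreover have "?l s \<noteq> x" if "s \<noteq> 0" for s
      proof
        assume "?l s = x"
        then have "s * d i = 0" for i by (metis add_cancel_right_right)
        then show False using that \<open>d \<noteq> _\<close> by auto
      qed
      ultimately show "\<forall>\<^sub>F s in at 0. P (?l s)"
        unfolding eventually_at_topological using U(3) by blast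
    qed
    from filterlim_compose[OF lim this]
    have "((\<lambda>s. (?F (?l s) - ?F x - einner p g (vdiff (?l s) x)) / enorm p (vdiff (?l s) x))
        \<longlongrightarrow> 0) (at 0)" .
    moreover have "vdiff (?l s) x = (\<lambda>i. s * d i)" for s
      by (auto simp: vdiff_def)
    moreover have "einner p g (\<lambda>i. s * d i) = s * einner p g d" for s
      by (simp add: einner_def sum_distrib_left mult_ac)
    moreover have "enorm p (\<lambda>i. s * d i) = \<bar>s\<bar> * enorm p d" for s
      unfolding enorm_def L2_set_def
      by (simp add: power_mult_distrib sum_distrib_left[symmetric] real_sqrt_mult)
    ultimately have "((\<lambda>s. (?F (?l s) - ?F x - s * einner p g d) / (\<bar>s\<bar> * enorm p d)) \<longlongrightarrow> 0) (at 0)"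
      by simp
    from tendsto_mult_left[OF this, of "enorm p d"]
    have "((\<lambda>s. (?F (?l s) - ?F x - s * einner p g d) / \<bar>s\<bar>) \<longlongrightarrow> 0) (at 0)"
      using dpos by simp
    from tendsto_rabs_zero[OF this]
    moreover have "\<bar>(?F (?l s) - ?F x - s * einner p g d) / \<bar>s\<bar>\<bar>
        = \<bar>(?F (?l s) - ?F x) / s - einner p g d\<bar>" if "s \<noteq> 0" for s
    proof -
      have "(?F (?l s) - ?F x - s * einner p g d) / s = (?F (?l s) - ?F x) / s - einner p g d"
        using that by (simp add: diff_divide_distrib)
      then show ?thesis by (metis abs_divide abs_abs)
    qed
    ultimately have "((\<lambda>s. \<bar>(?F (?l s) - ?F x) / s - einner p g d\<bar>) \<longlongrightarrow> 0) (at 0)"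
      by (elim Lim_transform_eventually) (simp add: eventually_at_filter)
    then have "((\<lambda>s. (?F (?l s) - ?F x) / s) \<longlongrightarrow> einner p g d) (at 0)"
      using LIM_zero_iff tendsto_rabs_zero_iff by blast
    then show ?thesis
      by (simp add: DERIV_def)
  qed
qed

text \<open>
  Two gradients give the same derivative in the direction of their difference, so the
  difference is orthogonal to itself. Uniqueness is what makes \<^const>\<open>grad\<close>, defined by a
  definite description, a gradient at all.
\<close>

lemma gateaux_gradient_unique:
  assumes "gateaux_gradient p h g x" "gateaux_gradient p h g' x" "g \<in> Rn p" "g' \<in> Rn p"
  shows "g = g'"
proof -
  have d: "vdiff g g' \<in> Rn p" using assms by (simp add: Rn_iff vdiff_def)
  then have "einner p g (vdiff g g') = einner p g' (vdiff g g')"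
    using assms(1,2) unfolding gateaux_gradient_def by (blast intro: DERIV_unique)
  then have "einner p (vdiff g g') (vdiff g g') = 0"
    by (simp add: einner_def vdiff_def left_diff_distrib sum_subtractf)
  from einner_self_eq_0D[OF this d] show ?thesis
    by (auto simp: vdiff_def fun_eq_iff)
qed

lemma grad_in_class:
  assumes "f \<in> S_class p m L" "x \<in> Rn p"
  shows "grad p f x \<in> Rn p" "gateaux_gradient p (\<lambda>y. real_of_ereal (f y)) (grad p f x) x"
proof -
  obtain g where g: "has_gradient p f g x"
    using assms by (auto simp: S_class_def)
  have "has_gradient p f (grad p f x) x"
    unfolding grad_def
  proof (rule theI[of _ g])
    fix g' assume "has_gradient p f g' x"
    then have "gateaux_gradient p (\<lambda>y. real_of_ereal (f y)) g' x" "g' \<in> Rn p"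
      using has_gradient_imp_gateaux_gradient[OF _ assms(2)] unfolding has_gradient_def by blast+
    moreover from g have "gateaux_gradient p (\<lambda>y. real_of_ereal (f y)) g x" "g \<in> Rn p"
      using has_gradient_imp_gateaux_gradient[OF _ assms(2)] unfolding has_gradient_def by blast+
    ultimately show "g' = g"
      by (intro gateaux_gradient_unique)
  qed (rule g)
  then show "grad p f x \<in> Rn p" "gateaux_gradient p (\<lambda>y. real_of_ereal (f y)) (grad p f x) x"
    using has_gradient_imp_gateaux_gradient[OF _ assms(2)] unfolding has_gradient_def by blast+
qed

lemma gateaux_gradient_line:
  assumes "gateaux_gradient p h g (\<lambda>i. x i + t * d i)" "d \<in> Rn p"
  shows "((\<lambda>s. h (\<lambda>i. x i + s * d i)) has_real_derivative einner p g d) (at t)"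
proof -
  have "((\<lambda>s. h (\<lambda>i. x i + (s + t) * d i)) has_real_derivative einner p g d) (at 0)"
    using assms unfolding gateaux_gradient_def by (simp add: algebra_simps)
  then show ?thesis
    using DERIV_shift[of "\<lambda>s. h (\<lambda>i. x i + s * d i)" _ 0 t] by simp
qed

section \<open>Smooth convex functions\<close>

text \<open>
  Subtract the right-hand side from \<open>h\<close> along the segment from \<open>x\<close> to \<open>x + d\<close>; the curvature
  condition says that the derivative of the result is nonnegative. The sign of \<open>c\<close> is free:
  \<open>c = 0\<close> gives the tangent inequality of convex functions, and \<open>c = - M\<close> applied to \<open>- h\<close>
  gives the quadratic upper bound for functions of curvature at most \<open>M\<close>.
\<close>

lemma curvature_lower_bound:
  assumes grad: "\<And>x. x \<in> Rn p \<Longrightarrow> gateaux_gradient p h (G x) x"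
    and curv: "\<And>x y. x \<in> Rn p \<Longrightarrow> y \<in> Rn p \<Longrightarrow>
      c * einner p (vdiff x y) (vdiff x y) \<le> einner p (vdiff (G x) (G y)) (vdiff x y)"
    and x: "x \<in> Rn p" and d: "d \<in> Rn p"
  shows "h x + einner p (G x) d + c / 2 * einner p d d \<le> h (\<lambda>i. x i + d i)"
proof -
  let ?l = "\<lambda>s i. x i + s * d i"
  define k where "k s = h (?l s) - s * einner p (G x) d - c / 2 * s\<^sup>2 * einner p d d" for s
  have der: "(k has_real_derivative
      einner p (G (?l s)) d - einner p (G x) d - c * s * einner p d d) (at s)" for s
    unfolding k_def
    by (auto intro!: derivative_eq_intros gateaux_gradient_line[OF grad[OF Rn_line[OF x d]] d])
  have "0 \<le> einner p (G (?l s)) d - einner p (G x) d - c * s * einner p d d" if "0 < s" for s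
  proof -
    have "vdiff (?l s) x = (\<lambda>i. s * d i)" by (auto simp: vdiff_def)
    moreover have "einner p (\<lambda>i. s * d i) (\<lambda>i. s * d i) = s * (s * einner p d d)"
      and "einner p (vdiff (G (?l s)) (G x)) (\<lambda>i. s * d i)
        = s * (einner p (G (?l s)) d - einner p (G x) d)"
      by (simp_all add: einner_def vdiff_def sum_distrib_left sum_subtractf[symmetric] algebra_simps)
    ultimately have "s * (c * s * einner p d d)
        \<le> s * (einner p (G (?l s)) d - einner p (G x) d)"
      using curv[OF Rn_line[OF x d, of s] x] by (simp add: mult_ac)
    then show ?thesis using that by simp
  qed
  moreover have "continuous_on {0..1} k"
    using der by (meson DERIV_isCont continuous_at_imp_continuous_on)
  ultimately have "k 0 \<le> k 1"
    using DERIV_nonneg_imp_increasing_open[of 0 1 k] der by fastforce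
  then show ?thesis by (simp add: k_def)
qed

text \<open>
  Bound \<open>h (a + d)\<close> from below by the tangent at \<open>b\<close> and from above by the quadratic model
  at \<open>a\<close>. The resulting inequality holds for every displacement \<open>d\<close>, and the best choice is
  \<open>d = (G b - G a) / M\<close>. Writing the conclusion with \<open>M\<close> as a factor instead of \<open>1 / M\<close> keeps
  it meaningful for \<open>M = 0\<close>, where it says that \<open>G\<close> is constant; this is the case of condition
  number \<open>1\<close>.
\<close>

lemma interpolation_inequality:
  assumes grad: "\<And>x. x \<in> Rn p \<Longrightarrow> gateaux_gradient p h (G x) x"
    and G: "\<And>x. x \<in> Rn p \<Longrightarrow> G x \<in> Rn p"
    and mono: "\<And>x y. x \<in> Rn p \<Longrightarrow> y \<in> Rn p \<Longrightarrow> 0 \<le> einner p (vdiff (G x) (G y)) (vdiff x y)"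
    and lip: "\<And>x y. x \<in> Rn p \<Longrightarrow> y \<in> Rn p \<Longrightarrow>
      einner p (vdiff (G x) (G y)) (vdiff x y) \<le> M * einner p (vdiff x y) (vdiff x y)"
    and M: "0 \<le> M" and a: "a \<in> Rn p" and b: "b \<in> Rn p"
  shows "einner p (vdiff (G a) (G b)) (vdiff (G a) (G b)) / 2
      \<le> M * (h a - h b - einner p (G b) (vdiff a b))"
proof -
  define g where "g = vdiff (G b) (G a)"
  define D where "D = h a - h b - einner p (G b) (vdiff a b)"
  let ?g = "einner p g g"
  have gR: "g \<in> Rn p" using G[OF a] G[OF b] by (simp add: g_def Rn_iff vdiff_def)
  have key: "(c - M / 2 * c\<^sup>2) * ?g \<le> D" for c
  proof -
    have dR: "(\<lambda>i. c * g i) \<in> Rn p" using gR by (simp add: Rn_iff)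
    have "- h a + einner p (\<lambda>i. - G a i) (\<lambda>i. c * g i)
          + (- M) / 2 * einner p (\<lambda>i. c * g i) (\<lambda>i. c * g i) \<le> - h (\<lambda>i. a i + c * g i)"
    proof (rule curvature_lower_bound[where p = p and h = "\<lambda>x. - h x" and G = "\<lambda>x i. - G x i", OF _ _ a dR])
      fix x assume "x \<in> Rn p"
      from grad[OF this] show "gateaux_gradient p (\<lambda>x. - h x) (\<lambda>i. - G x i) x"
        unfolding gateaux_gradient_def by (auto simp: einner_def sum_negf intro: derivative_eq_intros)
    next
      fix x y assume "x \<in> Rn p" "y \<in> Rn p"
      from lip[OF this]
      show "- M * einner p (vdiff x y) (vdiff x y)
          \<le> einner p (vdiff (\<lambda>i. - G x i) (\<lambda>i. - G y i)) (vdiff x y)"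
        by (simp add: einner_def vdiff_def sum_negf[symmetric] sum_subtractf algebra_simps)
    qed
    moreover have "h b + einner p (G b) (\<lambda>i. a i + c * g i - b i)
        + 0 / 2 * einner p (\<lambda>i. a i + c * g i - b i) (\<lambda>i. a i + c * g i - b i)
        \<le> h (\<lambda>i. b i + (a i + c * g i - b i))"
      using mono a gR b
      by (intro curvature_lower_bound[where p = p and G = G] grad b) (auto simp: Rn_iff)
    moreover have "einner p (G b) (\<lambda>i. a i + c * g i - b i)
        = einner p (G b) (vdiff a b) + c * einner p (G b) g"
      "einner p (\<lambda>i. c * g i) (\<lambda>i. c * g i) = c\<^sup>2 * ?g"
      "einner p (\<lambda>i. - G a i) (\<lambda>i. c * g i) = c * ?g - c * einner p (G b) g"
      by (simp_all add: einner_def g_def vdiff_def sum_distrib_left sum.distrib[symmetric]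
          sum_subtractf[symmetric] algebra_simps power2_eq_square)
    ultimately show ?thesis
      by (simp add: D_def algebra_simps)
  qed
  have "?g / 2 \<le> M * D"
  proof (cases "M = 0")
    case True
    have "?g = 0"
    proof (rule ccontr)
      assume "?g \<noteq> 0"
      \<comment> \<open>Without curvature the quadratic term is absent, so a large displacement violates the bound.\<close>
      then show False using key[of "(D + 1) / ?g"] True by simp
    qed
    then show ?thesis using True by simp
  next
    case False
    with M have "M > 0" by simp
    have "(1 / M - M / 2 * (1 / M)\<^sup>2) * ?g \<le> D" by (rule key)
    also have "(1 / M - M / 2 * (1 / M)\<^sup>2) * ?g = ?g / (2 * M)"
      using \<open>M > 0\<close> by (simp add: field_simps power2_eq_square)
    finally show ?thesis using \<open>M > 0\<close> by (simp add: field_simps)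
  qed
  moreover have "einner p (vdiff (G a) (G b)) (vdiff (G a) (G b)) = ?g"
    by (simp add: g_def einner_def vdiff_def algebra_simps)
  ultimately show ?thesis by (simp add: D_def)
qed

section \<open>The quadratic certificate\<close>

text \<open>
  This is \<open>n \<beta> / (2 (1 - s))\<close> with the value of \<open>\<beta>\<close> substituted, in a form that stays defined
  at \<open>s = 1\<close>.
\<close>

definition lyapunov_weight :: "real \<Rightarrow> real \<Rightarrow> real"
  where "lyapunov_weight n s = (1 + n + s) / (4 * (1 + s))"

text \<open>
  The quadratic part of the Lyapunov function, for one coordinate of two successive errors. Its
  coefficients are chosen so that the \<open>3 \<times> 3\<close> matrix of the one-step decrease has rank one.
\<close>

definition lyapunov_form :: "real \<Rightarrow> real \<Rightarrow> real \<Rightarrow> real \<Rightarrow> real"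
  where "lyapunov_form n s a b =
    (1 - lyapunov_weight n s) * a\<^sup>2 - (n + 1 - s) / 2 * (a * b) + (1 - s) * lyapunov_weight n s * b\<^sup>2"

lemma lyapunov_weight_bounds:
  assumes "0 \<le> n" "n \<le> 1" "0 \<le> s"
  shows "1 / 4 \<le> lyapunov_weight n s" "lyapunov_weight n s \<le> 1 / 2"
  using assms by (simp_all add: lyapunov_weight_def field_simps)

lemma lyapunov_weight_mult: "0 \<le> s \<Longrightarrow> 4 * lyapunov_weight n s * (1 + s) = 1 + n + s"
  by (simp add: lyapunov_weight_def field_simps)

text \<open>
  The heart of the convergence proof: along \<open>a = w\<^sub>t\<^sub>+\<^sub>1\<close>, \<open>b = w\<^sub>t\<close>, \<open>c = w\<^sub>t\<^sub>-\<^sub>1\<close> the decrease of the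
  Lyapunov form, corrected by the term that the interpolation inequalities control, is minus a
  nonnegative multiple of a square. With \<open>n \<beta> = 2 (1 - s) X\<close>, where \<open>X\<close> is the weight, the factor in front of \<open>a - (1 - s) b\<close> is the gradient
  of the reduced function at the extrapolated point.
\<close>

lemma lyapunov_form_step:
  assumes "n\<^sup>2 + s\<^sup>2 = 1" "0 \<le> s"
  shows "lyapunov_form n s a b - (1 - s) * lyapunov_form n s b c
      + (n * b + 2 * (1 - s) * lyapunov_weight n s * (b - c) - a) * (a - (1 - s) * b)
    = - (lyapunov_weight n s * (a - (1 + n - s) * b + (1 - s) * c)\<^sup>2)"
proof -
  define X where "X = lyapunov_weight n s"
  have X: "4 * X * (1 + s) = 1 + n + s" using lyapunov_weight_mult assms by (simp add: X_def)
  define l where "l = lyapunov_form n s a b - (1 - s) * lyapunov_form n s b c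
      + (n * b + 2 * (1 - s) * X * (b - c) - a) * (a - (1 - s) * b)"
  \<comment> \<open>The relation between \<open>X\<close>, \<open>n\<close> and \<open>s\<close> determines \<open>X\<close> only after division by \<open>1 + s\<close>.\<close>
  have "(4 * (1 + s)) * l = (4 * (1 + s)) * - (X * (a - (1 + n - s) * b + (1 - s) * c)\<^sup>2)"
    unfolding l_def lyapunov_form_def X_def[symmetric] using assms(1) X by algebra
  then have "l = - (X * (a - (1 + n - s) * b + (1 - s) * c)\<^sup>2)"
    using assms(2) by (subst (asm) mult_left_cancel) auto
  then show ?thesis by (simp add: l_def X_def)
qed

text \<open>
  Removing \<open>e a\<^sup>2\<close> with \<open>e = s (1 - n) / (2 (1 + n + s))\<close> makes the discriminant of the form zero,
  so what remains is a square divided by \<open>P > 0\<close>. Dividing by \<open>P\<close>, the remaining coefficient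
  of \<open>a\<^sup>2\<close>, and not by the coefficient of \<open>b\<^sup>2\<close>, covers \<open>s = 1\<close>, where the latter vanishes.
\<close>

lemma lyapunov_form_lower:
  assumes ns: "n\<^sup>2 + s\<^sup>2 = 1" and n: "0 \<le> n" and s: "0 \<le> s"
  shows "s * (1 - n) / (2 * (1 + n + s)) * a\<^sup>2 \<le> lyapunov_form n s a b"
proof -
  define X where "X = lyapunov_weight n s"
  define e where "e = s * (1 - n) / (2 * (1 + n + s))"
  define P where "P = (1 + n) * (1 + s) / (2 * (1 + n + s))"
  define q where "q = (n + 1 - s) / 4"
  define r where "r = (1 - s) * X"
  have X: "4 * X * (1 + s) = 1 + n + s" using lyapunov_weight_mult s by (simp add: X_def)
  have e: "2 * (1 + n + s) * e = s * (1 - n)" using n s by (simp add: e_def)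
  have P: "2 * (1 + n + s) * P = (1 + n) * (1 + s)" using n s by (simp add: P_def)
  have "0 < P" using n s by (simp add: P_def)
  have "4 * (1 + s) * (1 + n + s) * (1 - X) = 4 * (1 + s) * (1 + n + s) * (e + P)"
    using X e P ns by algebra
  then have p: "1 - X = e + P" using n s by (simp add: mult_less_0_iff)
  have "8 * (1 + s) * (1 + n + s) * q\<^sup>2 = 8 * (1 + s) * (1 + n + s) * (P * r)"
  proof -
    have "16 * q\<^sup>2 = (n + 1 - s)\<^sup>2" by (simp add: q_def power2_eq_square)
    then show ?thesis using X P ns unfolding r_def by algebra
  qed
  then have q: "q\<^sup>2 = P * r" using n s by simp
  have "P * (lyapunov_form n s a b - e * a\<^sup>2) = (P * a - q * b)\<^sup>2"
    using p q unfolding lyapunov_form_def X_def[symmetric] r_def q_def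
    by (simp add: field_simps) algebra
  then have "0 \<le> lyapunov_form n s a b - e * a\<^sup>2"
    using \<open>0 < P\<close> by (metis zero_le_mult_iff zero_le_power2 not_less less_eq_real_def)
  then show ?thesis by (simp add: e_def)
qed

text \<open>
  The first value of the Lyapunov function, after its function-value part has been bounded by an
  inner product. Maximizing over \<open>a\<close> leaves a quadratic form in the two initial errors. The factor
  \<open>1 - s\<close>, which is the square of the rate, matters for condition number \<open>1\<close>: it forces the
  Lyapunov function to vanish from the start.
\<close>

lemma lyapunov_form_start:
  assumes ns: "n\<^sup>2 + s\<^sup>2 = 1" and n: "0 \<le> n" and s: "0 \<le> s"
  shows "lyapunov_form n s a b + (n * b + 2 * (1 - s) * lyapunov_weight n s * (b - c) - a) * a
    \<le> 3 * (1 - s) * (b\<^sup>2 + c\<^sup>2)"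
proof -
  define X where "X = lyapunov_weight n s"
  have le1: "n \<le> 1" "s \<le> 1"
    using ns power2_le_imp_le[of n 1] power2_le_imp_le[of s 1] zero_le_power2[of n] zero_le_power2[of s]
    by simp_all
  have X: "1 / 4 \<le> X" "X \<le> 1 / 2" using lyapunov_weight_bounds[OF n le1(1) s] by (auto simp: X_def)
  define f where "f = 2 * (1 - s) * X"
  define e where "e = (n - (1 - s)) / 2 + f"
  define w where "w = e * b - f * c"
  have f: "(1 - s) / 2 \<le> f" "f \<le> 1 - s"
    using mult_left_mono[OF X(1), of "2 * (1 - s)"] mult_left_mono[OF X(2), of "2 * (1 - s)"] le1
    by (auto simp: f_def)
  have "f\<^sup>2 \<le> (1 - s)\<^sup>2" using f le1 by (intro power_mono) auto
  also have "\<dots> \<le> 1 - s" using s le1 by (simp add: power2_eq_square mult_left_le)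
  finally have f2: "f\<^sup>2 \<le> 1 - s" .
  have "e \<le> (n + (1 - s)) / 2" "0 \<le> e"
    using f n unfolding e_def by (simp_all add: field_simps)
  then have "e\<^sup>2 \<le> ((n + (1 - s)) / 2)\<^sup>2"
    by (rule power_mono)
  also have "\<dots> \<le> (n\<^sup>2 + (1 - s)\<^sup>2) / 2"
    using zero_le_power2[of "n - (1 - s)"] by (simp add: power2_eq_square field_simps)
  also have "\<dots> = 1 - s" using ns by (simp add: power2_eq_square field_simps)
  finally have e2: "e\<^sup>2 \<le> 1 - s" .
  have "w\<^sup>2 \<le> (e\<^sup>2 + f\<^sup>2) * (b\<^sup>2 + c\<^sup>2)"
    using zero_le_power2[of "e * c + f * b"] by (simp add: w_def power2_eq_square algebra_simps)
  also have "\<dots> \<le> (2 * (1 - s)) * (b\<^sup>2 + c\<^sup>2)"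
    using e2 f2 by (intro mult_right_mono) auto
  finally have w2: "w\<^sup>2 \<le> 2 * (1 - s) * (b\<^sup>2 + c\<^sup>2)" .
  have "w * a - X * a\<^sup>2 \<le> w\<^sup>2"
  proof -
    have "1 / 4 * a\<^sup>2 \<le> X * a\<^sup>2" using X by (intro mult_right_mono) auto
    moreover have "w * a - 1 / 4 * a\<^sup>2 \<le> w\<^sup>2"
      using zero_le_power2[of "w - a / 2"] by (simp add: power2_eq_square algebra_simps)
    ultimately show ?thesis by linarith
  qed
  moreover have "lyapunov_form n s a b + (n * b + f * (b - c) - a) * a
      = w * a - X * a\<^sup>2 + (1 - s) * X * b\<^sup>2"
    unfolding lyapunov_form_def X_def[symmetric] w_def e_def
    by (simp add: field_simps power2_eq_square)
  moreover have "(1 - s) * X * b\<^sup>2 \<le> (1 - s) * 1 * (b\<^sup>2 + c\<^sup>2)"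
    using le1 X by (intro mult_mono) auto
  ultimately show ?thesis using w2 unfolding f_def X_def by linarith
qed

section \<open>Potential and contraction\<close>

definition smooth_convex ::
    "nat \<Rightarrow> real \<Rightarrow> ((nat \<Rightarrow> real) \<Rightarrow> real) \<Rightarrow> ((nat \<Rightarrow> real) \<Rightarrow> nat \<Rightarrow> real) \<Rightarrow> bool"
  where "smooth_convex p M h G \<longleftrightarrow> 0 \<le> M \<and>
    (\<forall>x\<in>Rn p. G x \<in> Rn p \<and> gateaux_gradient p h (G x) x) \<and>
    (\<forall>x\<in>Rn p. \<forall>y\<in>Rn p.
       0 \<le> einner p (vdiff (G x) (G y)) (vdiff x y) \<and>
       einner p (vdiff (G x) (G y)) (vdiff x y) \<le> M * einner p (vdiff x y) (vdiff x y))"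

text \<open>
  The gap in the interpolation inequality between \<open>y\<close> and a minimizer \<open>z\<close>, multiplied by \<open>M\<close>.
  This is the function-value part of the Lyapunov function; \<open>M * y - G y\<close> is, up to a shift, the
  next iterate.
\<close>

definition potential ::
    "nat \<Rightarrow> real \<Rightarrow> ((nat \<Rightarrow> real) \<Rightarrow> real) \<Rightarrow> ((nat \<Rightarrow> real) \<Rightarrow> nat \<Rightarrow> real) \<Rightarrow>
     (nat \<Rightarrow> real) \<Rightarrow> (nat \<Rightarrow> real) \<Rightarrow> real"
  where "potential p M h G z y = M * (h y - h z) - einner p (G y) (G y) / 2"

text \<open>
  The interpolation inequality rewritten so that the only gradient paired with points is the one
  at \<open>b\<close>. In the method, the points \<open>M b - G b\<close> and \<open>M a - G a\<close> are, up to a common shift,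
  successive iterates.
\<close>

lemma potential_diff_le:
  assumes "smooth_convex p M h G" "a \<in> Rn p" "b \<in> Rn p"
  shows "potential p M h G z b - potential p M h G z a
    \<le> einner p (G b) (vdiff (\<lambda>i. M * b i - G b i) (\<lambda>i. M * a i - G a i))"
proof -
  have "einner p (vdiff (G a) (G b)) (vdiff (G a) (G b)) / 2
      \<le> M * (h a - h b - einner p (G b) (vdiff a b))"
    using assms by (intro interpolation_inequality) (auto simp: smooth_convex_def)
  moreover have "einner p (vdiff (G a) (G b)) (vdiff (G a) (G b)) / 2 + M * einner p (G b) (vdiff a b)
      = einner p (G a) (G a) / 2 - einner p (G b) (G b) / 2
        - einner p (G b) (vdiff (\<lambda>i. M * b i - G b i) (\<lambda>i. M * a i - G a i))"
    unfolding einner_def vdiff_def sum_divide_distrib sum_distrib_left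
      sum.distrib[symmetric] sum_subtractf[symmetric]
    by (rule sum.cong) (simp_all add: field_simps)
  ultimately show ?thesis
    unfolding potential_def right_diff_distrib by linarith
qed

lemma potential_nonneg:
  assumes "smooth_convex p M h G" "z \<in> Rn p" "y \<in> Rn p" "G z = (\<lambda>i. 0)"
  shows "0 \<le> potential p M h G z y"
proof -
  have "einner p (vdiff (G y) (G z)) (vdiff (G y) (G z)) / 2
      \<le> M * (h y - h z - einner p (G z) (vdiff y z))"
    using assms by (intro interpolation_inequality) (auto simp: smooth_convex_def)
  then show ?thesis
    using assms(4) by (simp add: potential_def vdiff_def einner_def)
qed

text \<open>
  Scaling by \<open>1 / L\<close> and subtracting the quadratic \<open>m / (2 L) \<parallel>y - z\<parallel>\<^sup>2\<close> moves the curvature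
  interval from \<open>[m, L]\<close> to \<open>[0, 1 - m / L]\<close>. Centering the quadratic at \<open>z\<close> keeps \<open>z\<close>
  stationary if it was stationary for \<open>f\<close>.
\<close>

lemma S_class_smooth_convex:
  assumes f: "f \<in> S_class p m L" and m: "0 < m" "m \<le> L" and z: "z \<in> Rn p"
  shows "smooth_convex p (1 - m / L)
    (\<lambda>y. real_of_ereal (f y) / L - m / (2 * L) * einner p (vdiff y z) (vdiff y z))
    (\<lambda>y i. grad p f y i / L - m / L * (y i - z i))"
  (is "smooth_convex p _ ?H ?D")
proof -
  have L: "L > 0" using m by simp
  have "?D x \<in> Rn p" if "x \<in> Rn p" for x
    using grad_in_class(1)[OF f that] that z by (simp add: Rn_iff)
  moreover have "gateaux_gradient p ?H (?D x) x" if x: "x \<in> Rn p" for x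
    unfolding gateaux_gradient_def
  proof
    fix d assume d: "d \<in> Rn p"
    have 1: "((\<lambda>s. real_of_ereal (f (\<lambda>i. x i + s * d i))) has_real_derivative einner p (grad p f x) d) (at 0)"
      using grad_in_class(2)[OF f x] d by (auto simp: gateaux_gradient_def)
    have 2: "((\<lambda>s. einner p (vdiff (\<lambda>i. x i + s * d i) z) (vdiff (\<lambda>i. x i + s * d i) z))
        has_real_derivative (\<Sum>i<p. 2 * (x i - z i) * d i)) (at 0)"
      unfolding einner_def vdiff_def
      by (rule derivative_eq_intros refl | simp add: algebra_simps)+
    have "((\<lambda>s. ?H (\<lambda>i. x i + s * d i)) has_real_derivative
        einner p (grad p f x) d / L - m / (2 * L) * (\<Sum>i<p. 2 * (x i - z i) * d i)) (at 0)"
      by (intro DERIV_diff DERIV_cdivide DERIV_cmult 1 2)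
    also have "einner p (grad p f x) d / L - m / (2 * L) * (\<Sum>i<p. 2 * (x i - z i) * d i)
        = einner p (?D x) d"
      unfolding einner_def sum_divide_distrib sum_distrib_left sum_subtractf[symmetric]
      using L by (intro sum.cong) (simp_all add: field_simps)
    finally show "((\<lambda>s. ?H (\<lambda>i. x i + s * d i)) has_real_derivative einner p (?D x) d) (at 0)" .
  qed
  moreover have "0 \<le> einner p (vdiff (?D x) (?D y)) (vdiff x y) \<and>
      einner p (vdiff (?D x) (?D y)) (vdiff x y) \<le> (1 - m / L) * einner p (vdiff x y) (vdiff x y)"
    if "x \<in> Rn p" "y \<in> Rn p" for x y
  proof -
    let ?e = "einner p (vdiff x y) (vdiff x y)"
    let ?g = "einner p (vdiff (grad p f x) (grad p f y)) (vdiff x y)"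
    have "m * ?e \<le> ?g" "?g \<le> L * ?e"
      using f that by (auto simp: S_class_def enorm_power2)
    then have "m / L * ?e \<le> ?g / L" "?g / L \<le> ?e"
      using L by (simp_all add: field_simps)
    moreover have "einner p (vdiff (?D x) (?D y)) (vdiff x y) = ?g / L - m / L * ?e"
      unfolding einner_def vdiff_def sum_divide_distrib sum_distrib_left sum_subtractf[symmetric]
      using L by (intro sum.cong) (simp_all add: field_simps)
    ultimately show ?thesis by (simp add: algebra_simps)
  qed
  ultimately show ?thesis
    using m by (simp add: smooth_convex_def)
qed

text \<open>
  The Lyapunov function \<open>V t\<close> is the Lyapunov form of the errors at \<open>t + 2\<close> and \<open>t + 1\<close> plus the
  potential at the point from which iterate \<open>t + 2\<close> was produced; iterate \<open>1\<close> is free, so there is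
  no such point before. Weighting the comparison with the minimizer by \<open>s\<close> and the comparison with
  the previous point by \<open>1 - s\<close> turns \<open>\<phi> (t + 1) - (1 - s) \<phi> t\<close> into the inner product occurring in
  \<open>lyapunov_form_step\<close>.
\<close>

lemma accelerated_contraction:
  fixes x :: "nat \<Rightarrow> nat \<Rightarrow> real"
  assumes conv: "smooth_convex p n h G"
    and z: "z \<in> Rn p" "G z = (\<lambda>i. 0)"
    and ns: "n\<^sup>2 + s\<^sup>2 = 1" "0 \<le> n" "0 \<le> s"
    and beta: "n * \<beta> = 2 * (1 - s) * lyapunov_weight n s"
    and x: "\<And>t. x t \<in> Rn p"
    and y: "\<And>t. y t = (\<lambda>i. (1 + \<beta>) * x (Suc t) i - \<beta> * x t i)"
    and step: "\<And>t i. x (Suc (Suc t)) i - z i = n * (y t i - z i) - G (y t) i"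
  shows "s * (1 - n) / (2 * (1 + n + s)) * einner p (vdiff (x (Suc t)) z) (vdiff (x (Suc t)) z)
    \<le> 3 * (1 - s) ^ t * (einner p (vdiff (x 1) z) (vdiff (x 1) z) + einner p (vdiff (x 0) z) (vdiff (x 0) z))"
proof -
  define X where "X = lyapunov_weight n s"
  define e where "e = s * (1 - n) / (2 * (1 + n + s))"
  define w where "w t i = x t i - z i" for t i
  define E where "E t = (\<Sum>i<p. (w t i)\<^sup>2)" for t
  define \<phi> where "\<phi> t = potential p n h G z (y t)" for t
  define V where "V t = (\<Sum>i<p. lyapunov_form n s (w (Suc (Suc t)) i) (w (Suc t) i)) + \<phi> t" for t
  have E: "einner p (vdiff (x t) z) (vdiff (x t) z) = E t" for t
    by (simp add: E_def einner_def vdiff_def w_def power2_eq_square)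
  have E0: "0 \<le> E t" for t by (simp add: E_def sum_nonneg)
  have s1: "n \<le> 1" "s \<le> 1"
    using ns(1) power2_le_imp_le[of n 1] power2_le_imp_le[of s 1] zero_le_power2[of n] zero_le_power2[of s]
    by simp_all
  have yR: "y t \<in> Rn p" for t using x by (simp add: y Rn_iff)
  have wstep: "w (Suc (Suc t)) i = n * (y t i - z i) - G (y t) i" for t i
    by (simp add: w_def step)
  have G: "G (y t) i = n * w (Suc t) i + 2 * (1 - s) * X * (w (Suc t) i - w t i) - w (Suc (Suc t)) i"
    for t i
  proof -
    have "y t i - z i = w (Suc t) i + \<beta> * (w (Suc t) i - w t i)"
      by (simp add: y w_def algebra_simps)
    then have "n * (y t i - z i) = n * w (Suc t) i + (n * \<beta>) * (w (Suc t) i - w t i)"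
      by (simp only: distrib_left mult.assoc)
    then show ?thesis using wstep[of t i] by (simp add: beta X_def)
  qed
  have phi0: "0 \<le> \<phi> t" for t
    unfolding \<phi>_def by (rule potential_nonneg[OF conv z(1) yR z(2)])
  have phi_start: "\<phi> t \<le> (\<Sum>i<p. G (y t) i * w (Suc (Suc t)) i)" for t
  proof -
    have "\<phi> t - potential p n h G z z
        \<le> einner p (G (y t)) (vdiff (\<lambda>i. n * y t i - G (y t) i) (\<lambda>i. n * z i - G z i))"
      unfolding \<phi>_def by (rule potential_diff_le[OF conv z(1) yR])
    moreover have "potential p n h G z z = 0" by (simp add: potential_def z einner_def)
    ultimately show ?thesis
      by (simp add: einner_def vdiff_def z wstep algebra_simps)
  qed
  have phi_step: "\<phi> (Suc t) - \<phi> t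
      \<le> (\<Sum>i<p. G (y (Suc t)) i * (w (Suc (Suc (Suc t))) i - w (Suc (Suc t)) i))" for t
    using potential_diff_le[OF conv yR[of t] yR[of "Suc t"], of z]
    by (simp add: \<phi>_def einner_def vdiff_def wstep algebra_simps)
  have low: "e * E (Suc (Suc t)) \<le> V t" for t
  proof -
    have "e * E (Suc (Suc t)) \<le> (\<Sum>i<p. lyapunov_form n s (w (Suc (Suc t)) i) (w (Suc t) i))"
      unfolding E_def sum_distrib_left e_def by (intro sum_mono lyapunov_form_lower ns)
    then show ?thesis using phi0[of t] by (simp add: V_def)
  qed
  have V0: "V 0 \<le> 3 * (1 - s) * (E 1 + E 0)"
  proof -
    have "V 0 \<le> (\<Sum>i<p. lyapunov_form n s (w 2 i) (w 1 i) + G (y 0) i * w 2 i)"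
      using phi_start[of 0] by (simp add: V_def sum.distrib numeral_2_eq_2)
    also have "\<dots> \<le> (\<Sum>i<p. 3 * (1 - s) * ((w 1 i)\<^sup>2 + (w 0 i)\<^sup>2))"
    proof (rule sum_mono)
      fix i
      show "lyapunov_form n s (w 2 i) (w 1 i) + G (y 0) i * w 2 i \<le> 3 * (1 - s) * ((w 1 i)\<^sup>2 + (w 0 i)\<^sup>2)"
        using lyapunov_form_start[OF ns, of "w 2 i" "w 1 i" "w 0 i"] G[of 0 i]
        by (simp add: X_def numeral_2_eq_2)
    qed
    finally show ?thesis by (simp add: E_def sum_distrib_left sum.distrib distrib_left)
  qed
  have Vstep: "V (Suc t) \<le> (1 - s) * V t" for t
  proof -
    let ?a = "w (Suc (Suc (Suc t)))" and ?b = "w (Suc (Suc t))" and ?c = "w (Suc t)"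
    let ?g = "G (y (Suc t))"
    have "\<phi> (Suc t) - (1 - s) * \<phi> t = s * \<phi> (Suc t) + (1 - s) * (\<phi> (Suc t) - \<phi> t)"
      by (simp add: algebra_simps)
    also have "\<dots> \<le> s * (\<Sum>i<p. ?g i * ?a i) + (1 - s) * (\<Sum>i<p. ?g i * (?a i - ?b i))"
      using phi_start[of "Suc t"] phi_step[of t] ns(3) s1 by (intro add_mono mult_left_mono) auto
    also have "\<dots> = (\<Sum>i<p. ?g i * (?a i - (1 - s) * ?b i))"
      unfolding sum_distrib_left sum.distrib[symmetric]
      by (intro sum.cong) (simp_all add: algebra_simps)
    finally have "V (Suc t) - (1 - s) * V t \<le> (\<Sum>i<p. lyapunov_form n s (?a i) (?b i)
        - (1 - s) * lyapunov_form n s (?b i) (?c i) + ?g i * (?a i - (1 - s) * ?b i))"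
      by (simp add: V_def sum.distrib sum_subtractf sum_distrib_left distrib_left)
    also have "\<dots> \<le> 0"
    proof (rule sum_nonpos)
      fix i
      have "0 \<le> X" using lyapunov_weight_bounds(1)[OF ns(2) s1(1) ns(3)] by (simp add: X_def)
      then show "lyapunov_form n s (?a i) (?b i) - (1 - s) * lyapunov_form n s (?b i) (?c i)
          + ?g i * (?a i - (1 - s) * ?b i) \<le> 0"
        using lyapunov_form_step[OF ns(1,3), of "?a i" "?b i" "?c i"] G[of "Suc t" i]
        by (simp add: X_def)
    qed
    finally show ?thesis by simp
  qed
  have V: "V t \<le> 3 * (1 - s) ^ Suc t * (E 1 + E 0)" for t
  proof (induction t)
    case 0
    then show ?case using V0 by simp
  next
    case (Suc t)
    have "(1 - s) * V t \<le> (1 - s) * (3 * (1 - s) ^ Suc t * (E 1 + E 0))"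
      using Suc s1 by (intro mult_left_mono) auto
    then show ?case using Vstep[of t] by (simp add: mult_ac)
  qed
  have "e * E (Suc t) \<le> 3 * (1 - s) ^ t * (E 1 + E 0)"
  proof (cases t)
    case 0
    have "s * (1 - n) \<le> 1 * 1" using ns s1 by (intro mult_mono) auto
    then have "e \<le> 3" using ns by (simp add: e_def divide_le_eq)
    then have "e * E 1 \<le> 3 * E 1" using E0 by (intro mult_right_mono)
    then show ?thesis using 0 E0[of 0] by simp
  next
    case (Suc t')
    then show ?thesis using low[of t'] V[of t'] by simp
  qed
  then show ?thesis by (simp add: E e_def)
qed

text \<open>
  The reparametrization behind the constants: \<open>(n, s)\<close> lies on the unit circle, the squared rate is
  \<open>1 - s\<close>, and \<open>\<beta> = (1 + n - s) / (2 (1 + s))\<close>. The product \<open>n \<beta>\<close> then has \<open>1 - s\<close> as a factor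
  because \<open>n\<^sup>2 = (1 - s) (1 + s)\<close>.
\<close>

lemma rate_parameters:
  fixes \<kappa> :: real
  assumes "\<kappa> \<ge> 1"
  defines "n \<equiv> 1 - 1 / \<kappa>" and "s \<equiv> sqrt (2 * \<kappa> - 1) / \<kappa>"
    and "\<beta> \<equiv> (2 * \<kappa> - sqrt (2 * \<kappa> - 1) - 1) / (2 * (\<kappa> + sqrt (2 * \<kappa> - 1)))"
  shows "n\<^sup>2 + s\<^sup>2 = 1" "0 \<le> n" "n < 1" "0 < s" "s \<le> 1"
    "n * \<beta> = 2 * (1 - s) * lyapunov_weight n s"
    "s = 1 \<Longrightarrow> \<kappa> = 1"
proof -
  have k: "\<kappa> > 0" using assms by simp
  show ns: "n\<^sup>2 + s\<^sup>2 = 1"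
    using assms(1) unfolding n_def s_def by (simp add: power_divide field_simps power2_eq_square)
  show "0 \<le> n" "n < 1" "0 < s" using assms(1) by (auto simp: n_def s_def)
  show "s \<le> 1"
    using ns power2_le_imp_le[of s 1] zero_le_power2[of n] by simp
  have "\<kappa> * (1 + n - s) = 2 * \<kappa> - sqrt (2 * \<kappa> - 1) - 1"
    and "\<kappa> * (2 * (1 + s)) = 2 * (\<kappa> + sqrt (2 * \<kappa> - 1))"
    using k by (simp_all add: n_def s_def field_simps)
  then have "\<beta> = (\<kappa> * (1 + n - s)) / (\<kappa> * (2 * (1 + s)))"
    by (simp add: \<beta>_def)
  then have "\<beta> = (1 + n - s) / (2 * (1 + s))" using k by simp
  then have "2 * (1 + s) * (n * \<beta>) = n * (1 + n - s)"
    using \<open>0 < s\<close> by simp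
  also have "\<dots> = (1 - s) * (4 * lyapunov_weight n s * (1 + s))"
    using lyapunov_weight_mult[of s n] \<open>0 < s\<close> ns by (simp add: power2_eq_square algebra_simps)
  finally have "(2 * (1 + s)) * (n * \<beta>) = (2 * (1 + s)) * (2 * (1 - s) * lyapunov_weight n s)"
    by algebra
  then show "n * \<beta> = 2 * (1 - s) * lyapunov_weight n s"
    using \<open>0 < s\<close> by (subst (asm) mult_left_cancel) auto
  show "\<kappa> = 1" if "s = 1"
    using ns that k by (simp add: n_def)
qed

theorem theorem7:
  shows "\<exists>C1 :: real \<Rightarrow> real.
    (\<forall>\<kappa>\<ge>1. C1 \<kappa> > 0) \<and>
    (\<forall>(p :: nat) (m :: real) (L :: real) (\<kappa> :: real) (\<alpha> :: real) (\<beta> :: real) (\<tau> :: real) (C0 :: real)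
       (f :: (nat \<Rightarrow> real) \<Rightarrow> ereal) (x :: nat \<Rightarrow> nat \<Rightarrow> real) (xstar :: nat \<Rightarrow> real).
       0 < m \<longrightarrow> m \<le> L \<longrightarrow>
       convex_fun p f \<longrightarrow> closed_fun p f \<longrightarrow> proper_fun p f \<longrightarrow> f \<in> S_class p m L \<longrightarrow>
       \<kappa> = L / m \<longrightarrow>
       \<alpha> = 1 / L \<longrightarrow>
       \<beta> = (2 * \<kappa> - sqrt (2 * \<kappa> - 1) - 1) / (2 * (\<kappa> + sqrt (2 * \<kappa> - 1))) \<longrightarrow>
       nesterov_iterates p \<alpha> \<beta> f x \<longrightarrow>
       nesterov_fixed_point p \<alpha> \<beta> f xstar \<longrightarrow>
       C0 = sqrt ((enorm p (vdiff (x 1) xstar))\<^sup>2 + (enorm p (vdiff (x 0) xstar))\<^sup>2) \<longrightarrow>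
       \<tau> = sqrt (1 - sqrt (2 * \<kappa> - 1) / \<kappa>) \<longrightarrow>
       (\<forall>t. \<not> (\<kappa> = 1 \<and> t = 1) \<longrightarrow>
          enorm p (vdiff (x t) xstar) \<le> C0 * C1 \<kappa> * \<tau> ^ t))"
proof -
  define s where "s \<kappa> = sqrt (2 * \<kappa> - 1) / \<kappa>" for \<kappa> :: real
  define n where "n \<kappa> = 1 - 1 / \<kappa>" for \<kappa> :: real
  define e where "e \<kappa> = s \<kappa> * (1 - n \<kappa>) / (2 * (1 + n \<kappa> + s \<kappa>))" for \<kappa>
  \<comment> \<open>The contraction estimate has the exponent \<open>t - 1\<close>, which costs a division by the rate.
    At \<open>\<kappa> = 1\<close> the rate is \<open>0\<close> and this quotient is \<open>0\<close>.\<close>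
  define C1 where "C1 \<kappa> = 1 + sqrt (3 / e \<kappa>) / sqrt (1 - s \<kappa>)" for \<kappa>
  have pos: "e \<kappa> > 0" "s \<kappa> \<le> 1" "C1 \<kappa> \<ge> 1" if "\<kappa> \<ge> 1" for \<kappa>
  proof -
    show 1: "s \<kappa> \<le> 1" using rate_parameters[OF that] by (simp add: s_def)
    have "0 < s \<kappa>" "0 \<le> n \<kappa>" "n \<kappa> < 1"
      using rate_parameters[OF that] by (simp_all only: s_def n_def)
    then show 2: "e \<kappa> > 0" by (simp add: e_def)
    show "C1 \<kappa> \<ge> 1" using 1 2 by (simp add: C1_def)
  qed
  have main: "enorm p (vdiff (x t) z) \<le> C0 * C1 \<kappa> * \<tau> ^ t"
    if m: "0 < m" "m \<le> L" and f: "f \<in> S_class p m L" and \<kappa>: "\<kappa> = L / m"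
      and \<alpha>: "\<alpha> = 1 / L"
      and \<beta>: "\<beta> = (2 * \<kappa> - sqrt (2 * \<kappa> - 1) - 1) / (2 * (\<kappa> + sqrt (2 * \<kappa> - 1)))"
      and it: "nesterov_iterates p \<alpha> \<beta> f x"
      and fixed: "nesterov_fixed_point p \<alpha> \<beta> f z"
      and C0: "C0 = sqrt ((enorm p (vdiff (x 1) z))\<^sup>2 + (enorm p (vdiff (x 0) z))\<^sup>2)"
      and \<tau>: "\<tau> = sqrt (1 - sqrt (2 * \<kappa> - 1) / \<kappa>)"
      and t: "\<not> (\<kappa> = 1 \<and> t = 1)"
    for p m L \<kappa> \<alpha> \<beta> \<tau> C0 f x z t
  proof -
    have L: "L > 0" and k1: "\<kappa> \<ge> 1" using m by (auto simp: \<kappa>)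
    note par = rate_parameters[OF k1, folded n_def s_def \<beta>]
    let ?G = "\<lambda>y i. grad p f y i / L - m / L * (y i - z i)"
    let ?y = "\<lambda>t i. (1 + \<beta>) * x (Suc t) i - \<beta> * x t i"
    have nL: "n \<kappa> = 1 - m / L" using m by (simp add: n_def \<kappa>)
    have zR: "z \<in> Rn p" and zfix: "nesterov_step p \<alpha> \<beta> f z z = z"
      using fixed by (auto simp: nesterov_fixed_point_def)
    have "?G z = (\<lambda>i. 0)"
    proof
      fix i
      show "?G z i = 0"
        using fun_cong[OF zfix, of i] L by (simp add: nesterov_step_def \<alpha> algebra_simps)
    qed
    have xstep: "x (Suc (Suc t)) i = ?y t i - grad p f (?y t) i / L" for t i
    proof -
      have "x (Suc t + 1) = nesterov_step p \<alpha> \<beta> f (x (Suc t - 1)) (x (Suc t))"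
        using it unfolding nesterov_iterates_def by (elim conjE allE[of _ "Suc t"]) simp
      then show ?thesis by (simp add: nesterov_step_def \<alpha>)
    qed
    have xR: "x t \<in> Rn p" for t
    proof (induction t rule: less_induct)
      case (less t)
      consider "t = 0" | "t = 1" | t' where "t = Suc (Suc t')"
        by (metis One_nat_def not0_implies_Suc)
      then show ?case
      proof cases
        case 3
        then have "?y t' \<in> Rn p" using less[of t'] less[of "Suc t'"] by (simp add: Rn_iff)
        then show ?thesis
          using grad_in_class(1)[OF f, of "?y t'"] 3 xstep[of t'] by (simp add: Rn_iff)
      qed (use it in \<open>simp_all add: nesterov_iterates_def\<close>)
    qed
    have C0_nonneg: "0 \<le> C0" by (simp add: C0)
    have C0sq: "C0\<^sup>2 = einner p (vdiff (x 1) z) (vdiff (x 1) z) + einner p (vdiff (x 0) z) (vdiff (x 0) z)"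
      by (simp add: C0 enorm_power2 einner_self_nonneg)
    have contr: "e \<kappa> * (enorm p (vdiff (x (Suc t)) z))\<^sup>2 \<le> 3 * (1 - s \<kappa>) ^ t * C0\<^sup>2" for t
      unfolding e_def C0sq enorm_power2
    proof (rule accelerated_contraction[where G = ?G and \<beta> = \<beta> and y = ?y])
      show "smooth_convex p (n \<kappa>)
          (\<lambda>y. real_of_ereal (f y) / L - m / (2 * L) * einner p (vdiff y z) (vdiff y z)) ?G"
        unfolding nL by (rule S_class_smooth_convex[OF f m zR])
      show "x (Suc (Suc t)) i - z i = n \<kappa> * (?y t i - z i) - ?G (?y t) i" for t i
        unfolding xstep nL by (simp add: algebra_simps)
    qed (use par zR xR \<open>?G z = _\<close> in auto)
    have tau: "\<tau> = sqrt (1 - s \<kappa>)" by (simp add: \<tau> s_def)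
    show ?thesis
    proof (cases t)
      case 0
      have "enorm p (vdiff (x 0) z) \<le> C0"
        by (rule power2_le_imp_le) (simp_all add: C0_nonneg C0sq enorm_power2 einner_self_nonneg)
      also have "\<dots> \<le> C0 * C1 \<kappa>" using C0_nonneg pos(3)[OF k1] by (simp add: mult_le_cancel_left1)
      finally show ?thesis using 0 by simp
    next
      case (Suc t')
      have e: "e \<kappa> > 0" and s1: "s \<kappa> \<le> 1" using pos[OF k1] by auto
      have "(enorm p (vdiff (x t) z))\<^sup>2 \<le> 3 / e \<kappa> * (1 - s \<kappa>) ^ t' * C0\<^sup>2"
        using contr[of t'] e by (simp add: Suc field_simps)
      also have "\<dots> = (sqrt (3 / e \<kappa>) * \<tau> ^ t' * C0)\<^sup>2"
        using e s1 by (simp add: tau power_mult_distrib real_sqrt_power[symmetric])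
      finally have *: "enorm p (vdiff (x t) z) \<le> sqrt (3 / e \<kappa>) * \<tau> ^ t' * C0"
        by (rule power2_le_imp_le) (use e s1 C0_nonneg in \<open>simp add: tau\<close>)
      have "sqrt (3 / e \<kappa>) * \<tau> ^ t' \<le> C1 \<kappa> * \<tau> ^ t"
      proof (cases "\<kappa> = 1")
        case True
        then have "\<tau> = 0" by (simp add: \<tau>)
        moreover have "t' \<noteq> 0" using t True Suc by auto
        ultimately show ?thesis by (simp add: Suc power_0_left)
      next
        case False
        then have "s \<kappa> < 1" using par(7) s1 by linarith
        then have "\<tau> > 0" by (simp add: tau)
        have "C1 \<kappa> * \<tau> ^ t = (\<tau> + sqrt (3 / e \<kappa>)) * \<tau> ^ t'"
        proof -
          have "C1 \<kappa> = 1 + sqrt (3 / e \<kappa>) / \<tau>" by (simp only: C1_def tau)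
          then have "C1 \<kappa> * \<tau> = \<tau> + sqrt (3 / e \<kappa>)"
            using \<open>\<tau> > 0\<close> by (simp add: distrib_right)
          then show ?thesis by (simp only: Suc power_Suc mult.assoc[symmetric])
        qed
        moreover have "sqrt (3 / e \<kappa>) * \<tau> ^ t' \<le> (\<tau> + sqrt (3 / e \<kappa>)) * \<tau> ^ t'"
          using \<open>\<tau> > 0\<close> by (intro mult_right_mono) simp_all
        ultimately show ?thesis by simp
      qed
      then have "sqrt (3 / e \<kappa>) * \<tau> ^ t' * C0 \<le> C1 \<kappa> * \<tau> ^ t * C0"
        using C0_nonneg by (rule mult_right_mono)
      with * show ?thesis by (simp add: mult_ac)
    qed
  qed
  show ?thesis
  proof (intro exI[of _ C1] conjI allI impI)
    show "C1 \<kappa> > 0" if "\<kappa> \<ge> 1" for \<kappa>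
      using pos(3)[OF that] by simp
  qed (rule main)
qed

end
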